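(* Let $\bar\ell<+\infty$ and let $h_0\ge 0$. Consider the set of constant controls $\tilde{\mathcal A}=\{\ell(t)\equiv l\ :\ l\in[\underline\ell,\bar\ell]\}$ and the problem $$\tilde W(h_0)=\sup_{\ell(\cdot)\in\tilde{\mathcal A}} J(\ell),\qquad J(\ell)=\int_0^\infty e^{-\rho t}\,\frac{\left(\frac{\ell(t)}{h^{h_0,\ell}(t)^\gamma}\right)^{1-\sigma}}{1-\sigma}\,dt ,$$ where $h^{h_0,\ell}$ solves $\dot h=\phi(\ell-h)$, $h(0)=h_0$. Then the maximum is attained at the constant control $\ell\equiv\bar\ell$, i.e. $\tilde W(h_0)=J(\bar\ell)$.
   Context: Parameters: $\rho>0$, $\phi>0$, $\sigma>1$, $\gamma<1$ with $\gamma(\sigma-1)>1$ (so $0<\gamma<1$), and $0\le\underline\ell<\bar\ell<+\infty$. The integrand $\frac{(\ell/h^\gamma)^{1-\sigma}}{1-\sigma}$ is understood as $\frac{\ell^{1-\sigma}h^{\gamma(\sigma-1)}}{1-\sigma}$, with value $-\infty$ when $\ell=0$. Explicitly, $h^{h_0,\ell}(t)=e^{-\phi t}\left[h_0+\phi\int_0^t e^{\phi s}\ell(s)\,ds\right]$. *)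

theory Defs
  imports "HOL-Analysis.Analysis"
begin

text \<open>Controls are functions of time; only their values at times \<open>t \<ge> 0\<close> matter.
  \<open>habit \<phi> h0 l\<close> is the solution of \<open>h' = \<phi> (l - h)\<close>, \<open>h 0 = h0\<close>
  (see \<open>habit_0\<close>, \<open>habit_ode\<close> and \<open>habit_unique\<close> below).\<close>

definition habit :: "real \<Rightarrow> real \<Rightarrow> (real \<Rightarrow> real) \<Rightarrow> real \<Rightarrow> real" where
  "habit \<phi> h0 l t = exp (- \<phi> * t) * (h0 + \<phi> * integral {0..t} (\<lambda>s. exp (\<phi> * s) * l s))"

lemma habit_0: "habit \<phi> h0 l 0 = h0"
  by (simp add: habit_def)

lemma habit_ode:
  assumes l: "continuous_on {0..} l" and t: "t \<ge> 0"
  shows "(habit \<phi> h0 l has_real_derivative \<phi> * (l t - habit \<phi> h0 l t)) (at t within {0..})"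
proof -
  let ?I = "\<lambda>t. integral {0..t} (\<lambda>s. exp (\<phi> * s) * l s)"
  have "continuous_on {0..t + 1} (\<lambda>s. exp (\<phi> * s) * l s)"
    by (intro continuous_intros continuous_on_subset[OF l]) auto
  then have "(?I has_real_derivative exp (\<phi> * t) * l t) (at t within {0..t + 1})"
    using t by (intro integral_has_real_derivative) auto
  moreover have "at t within {0..t + 1} = at t within {0..}"
    by (rule at_within_nhd[where S = "{..<t + 1}"]) auto
  ultimately have I: "(?I has_real_derivative exp (\<phi> * t) * l t) (at t within {0..})"
    by simp
  have e: "exp (- \<phi> * t) * exp (\<phi> * t) = 1"
    by (simp flip: exp_add)
  have "((\<lambda>t. exp (- \<phi> * t) * (h0 + \<phi> * ?I t)) has_real_derivative
      \<phi> * ((exp (- \<phi> * t) * exp (\<phi> * t)) * l t - exp (- \<phi> * t) * (h0 + \<phi> * ?I t)))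
      (at t within {0..})"
    by (rule derivative_eq_intros I refl)+ (simp add: algebra_simps)
  then show ?thesis
    unfolding e habit_def[abs_def] by simp
qed

lemma habit_unique:
  assumes l: "continuous_on {0..} l"
    and g0: "g 0 = h0"
    and g: "\<And>t. t \<ge> 0 \<Longrightarrow> (g has_real_derivative \<phi> * (l t - g t)) (at t within {0..})"
    and t: "t \<ge> 0"
  shows "g t = habit \<phi> h0 l t"
proof -
  let ?d = "\<lambda>t. exp (\<phi> * t) * (g t - habit \<phi> h0 l t)"
  have "(?d has_real_derivative 0) (at s within {0..})" if "s \<in> {0..}" for s
    using that by (auto intro!: derivative_eq_intros g habit_ode l simp: algebra_simps)
  then obtain c where c: "?d s = c" if "s \<in> {0..}" for s
    using has_field_derivative_zero_constant[of "{0::real..}" ?d] by auto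
  have "?d t = ?d 0"
    using c[of t] c[of 0] t by (simp only: atLeast_iff order_refl)
  then show ?thesis
    using g0 by (simp add: habit_0)
qed

text \<open>Meaningful unless positive and negative parts both have infinite integral.\<close>

definition ereal_integral :: "'a measure \<Rightarrow> ('a \<Rightarrow> ereal) \<Rightarrow> ereal" where
  "ereal_integral M f =
     enn2ereal (\<integral>\<^sup>+ x. e2ennreal (f x) \<partial>M) - enn2ereal (\<integral>\<^sup>+ x. e2ennreal (- f x) \<partial>M)"

text \<open>This is \<open>(l / h powr \<gamma>) powr (1 - \<sigma>) / (1 - \<sigma>)\<close>, rewritten so that it also has the intended
  value at \<open>h = 0\<close> (where division by zero would intervene) and at \<open>l = 0\<close>.\<close>

definition utility :: "real \<Rightarrow> real \<Rightarrow> real \<Rightarrow> real \<Rightarrow> ereal" where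
  "utility \<sigma> \<gamma> l h =
     (if l = 0 then -\<infinity> else ereal (l powr (1 - \<sigma>) * h powr (\<gamma> * (\<sigma> - 1)) / (1 - \<sigma>)))"

definition payoff ::
  "real \<Rightarrow> real \<Rightarrow> real \<Rightarrow> real \<Rightarrow> real \<Rightarrow> (real \<Rightarrow> real) \<Rightarrow> ereal" where
  "payoff \<rho> \<phi> \<sigma> \<gamma> h0 l =
     ereal_integral (restrict_space lborel {0..})
       (\<lambda>t. ereal (exp (- \<rho> * t)) * utility \<sigma> \<gamma> (l t) (habit \<phi> h0 l t))"

definition const_controls :: "real \<Rightarrow> real \<Rightarrow> (real \<Rightarrow> real) set" where
  "const_controls lmin lmax = {(\<lambda>t. c) | c. c \<in> {lmin..lmax}}"

definition const_value ::
  "real \<Rightarrow> real \<Rightarrow> real \<Rightarrow> real \<Rightarrow> real \<Rightarrow> real \<Rightarrow> real \<Rightarrow> ereal" where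
  "const_value \<rho> \<phi> \<sigma> \<gamma> lmin lmax h0 =
     (SUP l \<in> const_controls lmin lmax. payoff \<rho> \<phi> \<sigma> \<gamma> h0 l)"

end

theory Submission
  imports Defs
begin

text \<open>A larger constant control is at least as good at every single moment, so the comparison
  of the payoffs needs no computation of the integrals. Raising a positive constant level from \<open>l\<close> to
  \<open>L = c * l\<close> with \<open>c \<ge> 1\<close> raises the habit at each time by a factor of at most \<open>c\<close>, because the
  habit is a convex combination of the initial stock, which does not change, and the consumption
  level (lemma \<open>habit_const_scaled\<close>). In \<open>l / h powr \<gamma>\<close> the numerator therefore grows by \<open>c\<close> and
  the denominator by at most \<open>c powr \<gamma>\<close>, which is no more than \<open>c\<close> as \<open>\<gamma> < 1\<close>
  (lemma \<open>utility_mono_scaled\<close>). The level \<open>0\<close> is the worst one, since its utility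
  is \<open>-\<infinity>\<close> at all times. Integration preserves the order.\<close>

lemma ereal_integral_mono:
  assumes "\<And>x. x \<in> space M \<Longrightarrow> f x \<le> g x"
  shows "ereal_integral M f \<le> ereal_integral M g"
  unfolding ereal_integral_def
  by (intro ereal_minus_mono nn_integral_mono iffD1[OF less_eq_ennreal.rep_eq] e2ennreal_mono)
    (use assms in auto)

lemma habit_const:
  assumes "t \<ge> 0"
  shows "habit \<phi> h0 (\<lambda>t. l) t = exp (- \<phi> * t) * h0 + (1 - exp (- \<phi> * t)) * l"
  using assms
  by (intro habit_unique[symmetric])
    (auto intro!: derivative_eq_intros simp: algebra_simps)

lemma habit_const_nonneg:
  assumes "\<phi> \<ge> 0" "h0 \<ge> 0" "l \<ge> 0" "t \<ge> 0"
  shows "habit \<phi> h0 (\<lambda>t. l) t \<ge> 0"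
  using assms by (simp add: habit_const)

text \<open>The habit is affine and not linear in the control: the initial stock is not scaled, which
  for \<open>h0 \<ge> 0\<close> and \<open>c \<ge> 1\<close> keeps the new habit from exceeding the scaled one.\<close>

lemma habit_const_scaled:
  assumes "h0 \<ge> 0" "c \<ge> 1" "t \<ge> 0"
  shows "habit \<phi> h0 (\<lambda>t. c * l) t \<le> c * habit \<phi> h0 (\<lambda>t. l) t"
proof -
  have "exp (- \<phi> * t) * h0 \<le> c * (exp (- \<phi> * t) * h0)"
    using assms mult_right_mono[of 1 c "exp (- \<phi> * t) * h0"] by simp
  then show ?thesis
    using assms by (simp add: habit_const algebra_simps)
qed

text \<open>The disutility \<open>l powr (1 - \<sigma>) * h powr (\<gamma> * (\<sigma> - 1))\<close> is homogeneous of
  degree \<open>(\<gamma> - 1) * (\<sigma> - 1) \<le> 0\<close> in \<open>(l, h)\<close> and, as \<open>\<gamma> \<ge> 0\<close>, nondecreasing in \<open>h\<close>.\<close>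

lemma utility_mono_scaled:
  assumes "\<sigma> > 1" "0 \<le> \<gamma>" "\<gamma> \<le> 1" "l > 0" "c \<ge> 1" "0 \<le> k" "0 \<le> h" "k \<le> c * h"
  shows "utility \<sigma> \<gamma> l h \<le> utility \<sigma> \<gamma> (c * l) k"
proof -
  define a where "a = \<gamma> * (\<sigma> - 1)"
  have a: "0 \<le> a" "a \<le> \<sigma> - 1"
    using assms by (auto simp: a_def mult_left_le_one_le)
  have "k powr a \<le> (c * h) powr a"
    using assms a by (intro powr_mono2) auto
  also have "\<dots> = c powr a * h powr a"
    using assms by (simp add: powr_mult)
  also have "\<dots> \<le> c powr (\<sigma> - 1) * h powr a"
    using assms a by (intro mult_right_mono powr_mono) auto
  finally have "(c * l) powr (1 - \<sigma>) * k powr a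
      \<le> (c * l) powr (1 - \<sigma>) * (c powr (\<sigma> - 1) * h powr a)"
    by (intro mult_left_mono) auto
  also have "\<dots> = (c powr (1 - \<sigma>) * c powr (\<sigma> - 1)) * (l powr (1 - \<sigma>) * h powr a)"
    using assms by (simp add: powr_mult)
  also have "\<dots> = l powr (1 - \<sigma>) * h powr a"
    using assms by (simp flip: powr_add)
  finally have "l powr (1 - \<sigma>) * h powr a / (1 - \<sigma>) \<le> (c * l) powr (1 - \<sigma>) * k powr a / (1 - \<sigma>)"
    using assms by (intro divide_right_mono_neg) auto
  then show ?thesis
    using assms by (simp add: utility_def a_def)
qed

lemma utility_const_mono:
  assumes "\<phi> \<ge> 0" "\<sigma> > 1" "0 \<le> \<gamma>" "\<gamma> \<le> 1" "h0 \<ge> 0" "0 \<le> l" "l \<le> L" "t \<ge> 0"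
  shows "utility \<sigma> \<gamma> l (habit \<phi> h0 (\<lambda>t. l) t) \<le> utility \<sigma> \<gamma> L (habit \<phi> h0 (\<lambda>t. L) t)"
proof (cases "l = 0")
  case True
  then show ?thesis by (simp add: utility_def)
next
  case False
  define c where "c = L / l"
  have c: "L = c * l" "c \<ge> 1"
    using assms False by (auto simp: c_def)
  show ?thesis
    unfolding c(1) using assms False c
    by (intro utility_mono_scaled habit_const_scaled habit_const_nonneg) auto
qed

lemma payoff_const_mono:
  assumes "\<phi> \<ge> 0" "\<sigma> > 1" "0 \<le> \<gamma>" "\<gamma> \<le> 1" "h0 \<ge> 0" "0 \<le> l" "l \<le> L"
  shows "payoff \<rho> \<phi> \<sigma> \<gamma> h0 (\<lambda>t. l) \<le> payoff \<rho> \<phi> \<sigma> \<gamma> h0 (\<lambda>t. L)"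
  unfolding payoff_def using assms
  by (intro ereal_integral_mono ereal_mult_left_mono utility_const_mono)
    (auto simp: space_restrict_space)

theorem proposition2:
  fixes \<rho> \<phi> \<sigma> \<gamma> lmin lmax h0 :: real
  assumes "\<rho> > 0" and "\<phi> > 0" and "\<sigma> > 1" and "\<gamma> < 1" and "\<gamma> * (\<sigma> - 1) > 1"
    and "0 \<le> lmin" and "lmin < lmax" and "h0 \<ge> 0"
  shows "(\<lambda>t. lmax) \<in> const_controls lmin lmax
    \<and> (\<forall>l \<in> const_controls lmin lmax. payoff \<rho> \<phi> \<sigma> \<gamma> h0 l \<le> payoff \<rho> \<phi> \<sigma> \<gamma> h0 (\<lambda>t. lmax))
    \<and> const_value \<rho> \<phi> \<sigma> \<gamma> lmin lmax h0 = payoff \<rho> \<phi> \<sigma> \<gamma> h0 (\<lambda>t. lmax)"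
proof -
  have "0 < \<gamma> * (\<sigma> - 1)"
    using assms by linarith
  then have "0 \<le> \<gamma>"
    using assms by (simp add: zero_less_mult_iff)
  then have max: "payoff \<rho> \<phi> \<sigma> \<gamma> h0 l \<le> payoff \<rho> \<phi> \<sigma> \<gamma> h0 (\<lambda>t. lmax)"
    if "l \<in> const_controls lmin lmax" for l
    using that assms by (auto simp: const_controls_def intro!: payoff_const_mono)
  have mem: "(\<lambda>t. lmax) \<in> const_controls lmin lmax"
    using assms by (auto simp: const_controls_def)
  have "const_value \<rho> \<phi> \<sigma> \<gamma> lmin lmax h0 = payoff \<rho> \<phi> \<sigma> \<gamma> h0 (\<lambda>t. lmax)"
    unfolding const_value_def using mem max by (intro antisym SUP_least SUP_upper)
  with mem max show ?thesis by blast
qed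

end
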